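(* Let $K_1,\ldots,K_n$ be finite graded posets and $K:=K_1\times\cdots\times K_n$ with the product order. Then a map $M:K\to K$ is a special matching of $K$ if and only if $M=\mathrm{id}_{K_1}\times\cdots\times\mathrm{id}_{K_{i-1}}\times N\times\mathrm{id}_{K_{i+1}}\times\cdots\times\mathrm{id}_{K_n}$ for some $i\in\{1,\ldots,n\}$ and some special matching $N$ of $K_i$.
   Context: A finite poset is graded if it has a minimum, a maximum and a rank function. Write $x\vartriangleleft y$ if $y$ covers $x$. A matching of a finite graded poset $K$ is a map $M:K\to K$ with $M\circ M=\mathrm{id}_K$ and, for all $x$, $M(x)\vartriangleleft x$ or $x\vartriangleleft M(x)$; it is special if $x\vartriangleleft y$ and $x\neq M(y)$ imply $M(x)\leqslant M(y)$. *)

theory Defs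
  imports Main "HOL-Library.FuncSet"
begin

text \<open>
  A poset is a carrier \<open>A\<close> together with its order \<open>r\<close> as a relation, where \<open>(x, y) \<in> r\<close>
  means \<open>x \<le> y\<close>; the library predicate \<open>partial_order_on A r\<close> includes \<open>r \<subseteq> A \<times> A\<close>.
\<close>

definition covered_by :: "'a set \<Rightarrow> 'a rel \<Rightarrow> 'a \<Rightarrow> 'a \<Rightarrow> bool" where
  "covered_by A r x y \<longleftrightarrow>
     x \<in> A \<and> y \<in> A \<and> x \<noteq> y \<and> (x, y) \<in> r \<and>
     \<not> (\<exists>z\<in>A. z \<noteq> x \<and> z \<noteq> y \<and> (x, z) \<in> r \<and> (z, y) \<in> r)"

definition is_minimum :: "'a set \<Rightarrow> 'a rel \<Rightarrow> 'a \<Rightarrow> bool" where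
  "is_minimum A r b \<longleftrightarrow> b \<in> A \<and> (\<forall>x\<in>A. (b, x) \<in> r)"

definition is_maximum :: "'a set \<Rightarrow> 'a rel \<Rightarrow> 'a \<Rightarrow> bool" where
  "is_maximum A r t \<longleftrightarrow> t \<in> A \<and> (\<forall>x\<in>A. (x, t) \<in> r)"

text \<open>
  The rank function is normalized to vanish at the minimum. For a poset with a minimum this
  does not affect the existence of a rank function.
\<close>

definition rank_function :: "'a set \<Rightarrow> 'a rel \<Rightarrow> ('a \<Rightarrow> nat) \<Rightarrow> bool" where
  "rank_function A r \<rho> \<longleftrightarrow>
     (\<forall>b. is_minimum A r b \<longrightarrow> \<rho> b = 0) \<and>
     (\<forall>x y. covered_by A r x y \<longrightarrow> \<rho> y = \<rho> x + 1)"

definition finite_graded_poset :: "'a set \<Rightarrow> 'a rel \<Rightarrow> bool" where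
  "finite_graded_poset A r \<longleftrightarrow>
     finite A \<and> partial_order_on A r \<and>
     (\<exists>b. is_minimum A r b) \<and> (\<exists>t. is_maximum A r t) \<and> (\<exists>\<rho>. rank_function A r \<rho>)"

text \<open>
  Maps \<open>A \<rightarrow> A\<close> are taken extensional (equal to \<open>undefined\<close> outside \<open>A\<close>), so that equality of
  functions is equality of maps on \<open>A\<close>.
\<close>

definition matching :: "'a set \<Rightarrow> 'a rel \<Rightarrow> ('a \<Rightarrow> 'a) \<Rightarrow> bool" where
  "matching A r M \<longleftrightarrow>
     M \<in> A \<rightarrow>\<^sub>E A \<and> (\<forall>x\<in>A. M (M x) = x) \<and>
     (\<forall>x\<in>A. covered_by A r (M x) x \<or> covered_by A r x (M x))"

definition special_matching :: "'a set \<Rightarrow> 'a rel \<Rightarrow> ('a \<Rightarrow> 'a) \<Rightarrow> bool" where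
  "special_matching A r M \<longleftrightarrow>
     matching A r M \<and>
     (\<forall>x\<in>A. \<forall>y\<in>A. covered_by A r x y \<and> x \<noteq> M y \<longrightarrow> (M x, M y) \<in> r)"

text \<open>
  The product of a family \<open>(K j, r j)\<close>, \<open>j \<in> I\<close>, has carrier \<open>Pi\<^sub>E I K\<close>.
\<close>

definition product_order :: "'i set \<Rightarrow> ('i \<Rightarrow> 'a set) \<Rightarrow> ('i \<Rightarrow> 'a rel) \<Rightarrow> ('i \<Rightarrow> 'a) rel" where
  "product_order I K r =
     {(x, y). x \<in> Pi\<^sub>E I K \<and> y \<in> Pi\<^sub>E I K \<and> (\<forall>j\<in>I. (x j, y j) \<in> r j)}"

definition product_map ::
    "'i set \<Rightarrow> ('i \<Rightarrow> 'a set) \<Rightarrow> ('i \<Rightarrow> 'a \<Rightarrow> 'a) \<Rightarrow> ('i \<Rightarrow> 'a) \<Rightarrow> ('i \<Rightarrow> 'a)" where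
  "product_map I K f = (\<lambda>x\<in>Pi\<^sub>E I K. \<lambda>j\<in>I. f j (x j))"

end

theory Submission imports Defs begin

text \<open>
  A cover in the product changes exactly one coordinate, so a matching \<open>M\<close> moves every \<open>x\<close> in a
  single direction. Along a cover \<open>x \<lhd> y\<close> specialness forces \<open>M\<close> to move \<open>x\<close> and \<open>y\<close> in the same
  direction \<open>i\<close>, and to the same value if \<open>x i = y i\<close>. When \<open>M\<close> raises both elements or lowers
  both, this can be read off from \<open>M x \<le> M y\<close>. When \<open>M\<close> lowers \<open>x\<close> and raises \<open>y\<close>, comparing
  with the fourth corner of the square spanned by \<open>M x \<lhd> x \<lhd> y\<close> shows that both move in the
  direction of the cover. Since every element is reached from the minimum by a chain of
  covers, the direction is constant and \<open>M x i\<close> is a function of \<open>x i\<close>.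
\<close>

subsection \<open>Covers\<close>

lemma covered_by_converse: "covered_by A (r\<inverse>) x y \<longleftrightarrow> covered_by A r y x"
  unfolding covered_by_def by auto

lemma covered_by_between:
  assumes "covered_by A r x y" "z \<in> A" "(x, z) \<in> r" "(z, y) \<in> r"
  shows "z = x \<or> z = y"
  using assms unfolding covered_by_def by blast

lemma covered_by_asym:
  assumes "partial_order_on A r" "covered_by A r x y" "covered_by A r y x"
  shows False
  using assms unfolding covered_by_def partial_order_on_def antisym_def by blast

lemma covered_by_eqI:
  assumes "covered_by A r x a" "covered_by A r x b" "(a, b) \<in> r"
  shows "a = b"
  using covered_by_between[OF assms(2) _ _ assms(3)] assms(1) by (auto simp: covered_by_def)

text \<open>Among the elements strictly below \<open>x\<close>, one with the largest down-set is
  maximal: anything strictly between it and \<open>x\<close> would have a larger down-set.\<close>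

lemma exists_lower_cover:
  assumes "finite A" "partial_order_on A r" "(b, x) \<in> r" "b \<noteq> x"
  obtains c where "covered_by A r c x"
proof -
  have tr: "trans r" and an: "antisym r" and sub: "r \<subseteq> A \<times> A"
    using assms(2) by (auto simp: partial_order_on_def preorder_on_def refl_on_def)
  define S where "S = {z \<in> A. (z, x) \<in> r \<and> z \<noteq> x}"
  have fin: "finite S" and ne: "S \<noteq> {}"
    using assms sub by (auto simp: S_def)
  define d where "d z = card {w \<in> A. (w, z) \<in> r}" for z
  obtain c where c: "c \<in> S" and c_max: "\<And>z. z \<in> S \<Longrightarrow> d z \<le> d c"
    using Max_in[of "d ` S"] Max_ge[of "d ` S"] fin ne by fastforce
  have "covered_by A r c x"
    unfolding covered_by_def
  proof (intro conjI notI)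
    assume "\<exists>z\<in>A. z \<noteq> c \<and> z \<noteq> x \<and> (c, z) \<in> r \<and> (z, x) \<in> r"
    then obtain z where z: "z \<in> A" "z \<noteq> c" "z \<noteq> x" "(c, z) \<in> r" "(z, x) \<in> r"
      by blast
    have "(z, z) \<in> r"
      using assms(2) z(1) by (auto simp: partial_order_on_def preorder_on_def refl_on_def)
    moreover have "(z, c) \<notin> r"
      using an z by (auto dest: antisymD)
    ultimately have "{w \<in> A. (w, c) \<in> r} \<subset> {w \<in> A. (w, z) \<in> r}"
      using z tr by (blast dest: transD)
    then have "d c < d z"
      unfolding d_def by (intro psubset_card_mono) (use assms(1) in auto)
    with c_max[of z] z show False
      by (simp add: S_def)
  qed (use c sub assms(3) in \<open>auto simp: S_def\<close>)
  with that show thesis .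
qed

text \<open>Strong induction on the size of the down-set: an element other than the minimum has a
  lower cover, whose down-set is strictly smaller.\<close>

lemma covered_by_induct:
  assumes "finite A" "partial_order_on A r" "is_minimum A r b" "x \<in> A"
    and base: "P b"
    and step: "\<And>x y. covered_by A r x y \<Longrightarrow> P x \<Longrightarrow> P y"
  shows "P x"
  using \<open>x \<in> A\<close>
proof (induction "card {w \<in> A. (w, x) \<in> r}" arbitrary: x rule: less_induct)
  case less
  show ?case
  proof (cases "b = x")
    case True
    then show ?thesis using base by simp
  next
    case False
    have "(b, x) \<in> r"
      using assms(3) less.prems by (simp add: is_minimum_def)
    then obtain c where c: "covered_by A r c x"
      using exists_lower_cover[OF assms(1,2) _ False] by blast
    have "(x, x) \<in> r" "trans r" "antisym r"
      using assms(2) less.prems by (auto simp: partial_order_on_def preorder_on_def refl_on_def)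
    with c have "{w \<in> A. (w, c) \<in> r} \<subset> {w \<in> A. (w, x) \<in> r}"
      unfolding covered_by_def by (blast dest: transD antisymD)
    then have "card {w \<in> A. (w, c) \<in> r} < card {w \<in> A. (w, x) \<in> r}"
      by (intro psubset_card_mono) (use assms(1) in auto)
    then have "P c"
      using less.hyps c by (simp add: covered_by_def)
    with step c show ?thesis by blast
  qed
qed

subsection \<open>Special matchings\<close>

lemma matching_cases:
  assumes "matching A r M" "x \<in> A"
  obtains (down) "covered_by A r (M x) x" | (up) "covered_by A r x (M x)"
  using assms unfolding matching_def by blast

lemma matching_involution:
  assumes "matching A r M" "x \<in> A"
  shows "M x \<in> A" "M (M x) = x"
  using assms unfolding matching_def by auto

text \<open>The involution turns the exception \<open>x = M y\<close> of the definition into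
  \<open>M x = y\<close>, the form used in the case distinctions below.\<close>

lemma special_matching_le:
  assumes "special_matching A r M" "covered_by A r x y" "M x \<noteq> y"
  shows "(M x, M y) \<in> r"
proof -
  have xy: "x \<in> A" "y \<in> A"
    using assms(2) by (auto simp: covered_by_def)
  moreover have "matching A r M"
    using assms(1) by (simp add: special_matching_def)
  ultimately have "x \<noteq> M y"
    using assms(3) matching_involution(2) by metis
  with assms xy show ?thesis
    by (auto simp: special_matching_def)
qed

text \<open>Reversal exchanges \<open>x\<close> and \<open>y\<close>, and the excluded case is
  symmetric in them because \<open>M\<close> is an involution. This halves the case analysis
  below.\<close>

lemma special_matching_converse:
  assumes "special_matching A r M"
  shows "special_matching A (r\<inverse>) M"
proof -
  have "(M y, M x) \<in> r" if "covered_by A r y x" "x \<noteq> M y" for x y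
    using special_matching_le[OF assms that(1)] that(2) by simp
  moreover have "matching A (r\<inverse>) M"
    using assms by (auto simp: special_matching_def matching_def covered_by_converse)
  ultimately show ?thesis
    by (simp add: special_matching_def covered_by_converse)
qed

text \<open>Otherwise \<open>M x\<close> \<le> \<open>M y\<close> \<lhd> \<open>y\<close> would
  place \<open>M x\<close> strictly between \<open>x\<close> and \<open>y\<close>.\<close>

lemma special_matching_up_down:
  assumes "partial_order_on A r" "special_matching A r M" "covered_by A r x y"
    and "covered_by A r x (M x)" "covered_by A r (M y) y"
  shows "M x = y"
proof (rule ccontr)
  assume neq: "M x \<noteq> y"
  then have le: "(M x, M y) \<in> r"
    using special_matching_le assms(2,3) by metis
  have tr: "trans r"
    using assms(1) by (simp add: partial_order_on_def preorder_on_def)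
  then have "(M x, y) \<in> r"
    using le assms(5) by (auto simp: covered_by_def dest: transD)
  with neq show False
    using covered_by_between[OF assms(3), of "M x"] assms(4) by (auto simp: covered_by_def)
qed

subsection \<open>Products of posets\<close>

locale poset_family =
  fixes I :: "'i set" and K :: "'i \<Rightarrow> 'a set" and r :: "'i \<Rightarrow> 'a rel"
  assumes partial_order: "j \<in> I \<Longrightarrow> partial_order_on (K j) (r j)"
begin

abbreviation P where "P \<equiv> Pi\<^sub>E I K"
abbreviation R where "R \<equiv> product_order I K r"

lemma refl: "j \<in> I \<Longrightarrow> a \<in> K j \<Longrightarrow> (a, a) \<in> r j"
  using partial_order by (auto simp: partial_order_on_def preorder_on_def refl_on_def)

lemma trans: "j \<in> I \<Longrightarrow> (a, b) \<in> r j \<Longrightarrow> (b, c) \<in> r j \<Longrightarrow> (a, c) \<in> r j"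
  using partial_order by (auto simp: partial_order_on_def preorder_on_def dest: transD)

lemma antisym: "j \<in> I \<Longrightarrow> (a, b) \<in> r j \<Longrightarrow> (b, a) \<in> r j \<Longrightarrow> a = b"
  using partial_order by (auto simp: partial_order_on_def dest: antisymD)

lemma partial_order_product: "partial_order_on P R"
  unfolding partial_order_on_def preorder_on_def
proof (intro conjI)
  show "R \<subseteq> P \<times> P"
    by (auto simp: product_order_def)
  show "refl_on P R"
    by (auto simp: refl_on_def product_order_def intro: refl)
  show "Relation.trans R"
    by (rule transI) (auto simp: product_order_def intro: trans)
  show "Relation.antisym R"
  proof (rule antisymI)
    fix x y assume "(x, y) \<in> R" "(y, x) \<in> R"
    then show "x = y"
      by (intro PiE_ext[of x I K]) (auto simp: product_order_def intro: antisym)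
  qed
qed

lemma is_minimum_product:
  assumes "\<And>j. j \<in> I \<Longrightarrow> is_minimum (K j) (r j) (b j)"
  shows "is_minimum P R (restrict b I)"
  using assms by (auto simp: is_minimum_def product_order_def)

section \<open>Covers in the product order\<close>

lemma upd_in_P: "x \<in> P \<Longrightarrow> j \<in> I \<Longrightarrow> a \<in> K j \<Longrightarrow> x(j := a) \<in> P"
  by (auto simp: PiE_def extensional_def)

text \<open>By antisymmetry an element between \<open>x\<close> and \<open>x(j := a)\<close> agrees
  with \<open>x\<close> off \<open>j\<close>, and the cover in the factor leaves only two values at
  \<open>j\<close>.\<close>

lemma covered_by_updI:
  assumes "x \<in> P" "j \<in> I" "covered_by (K j) (r j) (x j) a"
  shows "covered_by P R x (x(j := a))"
  unfolding covered_by_def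
proof (intro conjI notI)
  have a: "a \<in> K j" "x j \<noteq> a" "(x j, a) \<in> r j"
    using assms by (auto simp: covered_by_def)
  show P: "x \<in> P" "x(j := a) \<in> P"
    using assms a by (auto intro: upd_in_P)
  show "False" if "x = x(j := a)"
    using a(2) fun_cong[OF that, of j] by simp
  show "(x, x(j := a)) \<in> R"
    using P a by (auto simp: product_order_def intro: refl)
  assume "\<exists>z\<in>P. z \<noteq> x \<and> z \<noteq> x(j := a) \<and> (x, z) \<in> R \<and> (z, x(j := a)) \<in> R"
  then obtain z where z: "z \<in> P" "z \<noteq> x" "z \<noteq> x(j := a)" "(x, z) \<in> R" "(z, x(j := a)) \<in> R"
    by blast
  have le: "(x k, z k) \<in> r k" "(z k, (x(j := a)) k) \<in> r k" if "k \<in> I" for k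
    using z(4,5) that by (auto simp: product_order_def)
  have off: "z k = x k" if "k \<in> I" "k \<noteq> j" for k
    using le[OF that(1)] that by (auto intro: antisym)
  have "z j = x j \<or> z j = a"
    using covered_by_between[OF assms(3), of "z j"] le[OF assms(2)] z(1) assms(2) by auto
  then show False
  proof
    assume "z j = x j"
    then have "z = x"
      using off z(1) P(1) by (intro PiE_ext[of z I K x]) metis+
    with z show False by simp
  next
    assume "z j = a"
    then have "z = x(j := a)"
      using off z(1) P(2) by (intro PiE_ext[of z I K "x(j := a)"]) auto
    with z show False by simp
  qed
qed

text \<open>If \<open>x\<close> and \<open>y\<close> differ at \<open>j\<close>, each
  \<open>a\<close> between \<open>x j\<close> and \<open>y j\<close> gives an element
  \<open>x(j := a)\<close> between \<open>x\<close> and \<open>y\<close>, hence one of the two. The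
  choice \<open>a = y j\<close> shows that they differ only at \<open>j\<close>; the other choices
  give the cover in the factor.\<close>

lemma covered_by_productE:
  assumes "covered_by P R x y"
  obtains j where "j \<in> I" "covered_by (K j) (r j) (x j) (y j)" "y = x(j := y j)"
proof -
  have P: "x \<in> P" "y \<in> P" and "x \<noteq> y" and "(x, y) \<in> R"
    using assms by (auto simp: covered_by_def)
  then have le: "(x k, y k) \<in> r k" if "k \<in> I" for k
    using that by (auto simp: product_order_def)
  obtain j where j: "j \<in> I" "x j \<noteq> y j"
    using PiE_ext[OF P] \<open>x \<noteq> y\<close> by blast
  have yj: "y j \<in> K j"
    using P j by auto
  have between: "x(j := a) = x \<or> x(j := a) = y" if "a \<in> K j" "(x j, a) \<in> r j" "(a, y j) \<in> r j" for a
  proof (rule covered_by_between[OF assms])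
    show aP: "x(j := a) \<in> P"
      using P j that by (auto intro: upd_in_P)
    show "(x, x(j := a)) \<in> R"
      using aP P that by (auto simp: product_order_def intro: refl)
    show "(x(j := a), y) \<in> R"
      using aP P that le by (auto simp: product_order_def)
  qed
  have "x(j := y j) \<noteq> x"
    using j(2) by (metis fun_upd_same)
  then have "y = x(j := y j)"
    using between[of "y j"] yj le[OF j(1)] refl[OF j(1) yj] by auto
  moreover have "covered_by (K j) (r j) (x j) (y j)"
    unfolding covered_by_def
  proof (intro conjI notI)
    assume "\<exists>z\<in>K j. z \<noteq> x j \<and> z \<noteq> y j \<and> (x j, z) \<in> r j \<and> (z, y j) \<in> r j"
    then obtain z where z: "z \<in> K j" "z \<noteq> x j" "z \<noteq> y j" "(x j, z) \<in> r j" "(z, y j) \<in> r j"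
      by blast
    then show False
      using between[of z] by (metis fun_upd_same)
  qed (use P j le in auto)
  ultimately show thesis
    using that j(1) by blast
qed

text \<open>The coordinate comes from the cover between \<open>x\<close> and \<open>M x\<close>.
  Both orientations are offered as implications; the one that does not occur holds vacuously, since
  covering is asymmetric.\<close>

lemma matching_direction:
  assumes "matching P R M" "x \<in> P"
  obtains i where "i \<in> I" "M x i \<noteq> x i" "M x = x(i := M x i)"
    "covered_by P R x (M x) \<Longrightarrow> covered_by (K i) (r i) (x i) (M x i)"
    "covered_by P R (M x) x \<Longrightarrow> covered_by (K i) (r i) (M x i) (x i)"
  using assms
proof (cases rule: matching_cases)
  case down
  with covered_by_asym[OF partial_order_product] have no: "\<not> covered_by P R x (M x)"
    by blast
  from down obtain i where i: "i \<in> I" "covered_by (K i) (r i) (M x i) (x i)" "x = (M x)(i := x i)"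
    by (rule covered_by_productE)
  have "M x = x(i := M x i)"
    using fun_cong[OF i(3)] by (auto simp: fun_eq_iff split: if_splits)
  moreover have "M x i \<noteq> x i"
    using i(2) by (auto simp: covered_by_def)
  ultimately show thesis
    using that i(1,2) no by blast
next
  case up
  with covered_by_asym[OF partial_order_product] have no: "\<not> covered_by P R (M x) x"
    by blast
  from up obtain i where i: "i \<in> I" "covered_by (K i) (r i) (x i) (M x i)" "M x = x(i := M x i)"
    by (rule covered_by_productE)
  moreover have "M x i \<noteq> x i"
    using i(2) by (auto simp: covered_by_def)
  ultimately show thesis
    using that no by blast
qed

section \<open>Duality and the direction of moves along a cover\<close>

lemma poset_family_converse: "poset_family I K (\<lambda>j. (r j)\<inverse>)"
  using partial_order by unfold_locales simp

lemma product_order_converse: "product_order I K (\<lambda>j. (r j)\<inverse>) = R\<inverse>"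
  by (auto simp: product_order_def)

lemmas dual_simps = product_order_converse covered_by_converse

text \<open>The first four conjuncts determine \<open>i\<close>. The last one is what later makes
  \<open>M x i\<close> a function of \<open>x i\<close>. No order occurs, so the predicate is the
  same for the reversed orders.\<close>

definition parallel :: "(('i \<Rightarrow> 'a) \<Rightarrow> ('i \<Rightarrow> 'a)) \<Rightarrow> ('i \<Rightarrow> 'a) \<Rightarrow> ('i \<Rightarrow> 'a) \<Rightarrow> bool" where
  "parallel M x y \<longleftrightarrow> (\<exists>i\<in>I. M x i \<noteq> x i \<and> M y i \<noteq> y i \<and>
     M x = x(i := M x i) \<and> M y = y(i := M y i) \<and> (x i = y i \<longrightarrow> M x i = M y i))"

lemma parallel_sym: "parallel M x y \<Longrightarrow> parallel M y x"
  unfolding parallel_def by metis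

text \<open>Let \<open>M\<close> raise \<open>x\<close> at \<open>i\<close> and \<open>y\<close> at
  \<open>k\<close>. If \<open>k\<close> \<noteq> \<open>i\<close>, then \<open>M x i\<close> \<le>
  \<open>y i\<close>; this forces \<open>M x = y\<close> when the cover runs in direction
  \<open>i\<close>, and the absurd \<open>M x i\<close> \<le> \<open>x i\<close> otherwise. If
  \<open>k = i\<close> and \<open>x i = y i\<close>, the comparable upper covers
  \<open>M x i\<close> and \<open>M y i\<close> of one element coincide.\<close>

lemma parallel_up_up:
  assumes sp: "special_matching P R M" and xy: "covered_by P R x y" and neq: "M x \<noteq> y"
    and ux: "covered_by P R x (M x)" and uy: "covered_by P R y (M y)"
  shows "parallel M x y"
proof -
  have m: "matching P R M"
    using sp by (simp add: special_matching_def)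
  have P: "x \<in> P" "y \<in> P"
    using xy by (auto simp: covered_by_def)
  obtain i where i: "i \<in> I" "M x i \<noteq> x i" "M x = x(i := M x i)"
    "covered_by (K i) (r i) (x i) (M x i)"
    using matching_direction[OF m P(1)] ux by metis
  obtain k where k: "k \<in> I" "M y k \<noteq> y k" "M y = y(k := M y k)"
    "covered_by (K k) (r k) (y k) (M y k)"
    using matching_direction[OF m P(2)] uy by metis
  obtain j where j: "j \<in> I" "covered_by (K j) (r j) (x j) (y j)" "y = x(j := y j)"
    using xy by (rule covered_by_productE)
  have "(M x, M y) \<in> R"
    using special_matching_le[OF sp xy neq] .
  then have le: "(M x i, M y i) \<in> r i"
    using i(1) by (auto simp: product_order_def)
  have "k = i"
  proof (rule ccontr)
    assume "k \<noteq> i"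
    then have "M y i = y i"
      using k(3) by (metis fun_upd_other)
    then have le': "(M x i, y i) \<in> r i"
      using le by simp
    show False
    proof (cases "j = i")
      case True
      then have "M x i = y i"
        using covered_by_eqI[OF i(4) _ le'] j(2) by simp
      then show False
        using True i(3) j(3) neq by metis
    next
      case False
      then have "y i = x i"
        using j(3) by (metis fun_upd_other)
      then show False
        using le' i antisym[OF i(1)] by (auto simp: covered_by_def)
    qed
  qed
  moreover have "M x i = M y i" if "x i = y i"
    using covered_by_eqI[OF i(4) _ le] k(4) that \<open>k = i\<close> by simp
  ultimately show ?thesis
    unfolding parallel_def using i k by blast
qed

text \<open>Reversing the order makes \<open>y\<close> the lower element and both moves raises,
  which is the previous case.\<close>

lemma parallel_down_down:
  assumes "special_matching P R M" "covered_by P R x y" "M x \<noteq> y"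
    and "covered_by P R (M x) x" "covered_by P R (M y) y"
  shows "parallel M x y"
proof -
  interpret dual: poset_family I K "\<lambda>j. (r j)\<inverse>"
    by (rule poset_family_converse)
  have "x \<in> P" "y \<in> P" "matching P R M"
    using assms by (auto simp: covered_by_def special_matching_def)
  then have "M y \<noteq> x"
    using assms(3) matching_involution(2) by metis
  then have "dual.parallel M y x"
    using assms
    by (intro dual.parallel_up_up) (simp_all add: dual_simps special_matching_converse)
  then have "parallel M y x"
    unfolding parallel_def dual.parallel_def .
  then show ?thesis
    by (rule parallel_sym)
qed

text \<open>Here \<open>j\<close> is the direction of the cover. Suppose \<open>M\<close> lowers
  \<open>x\<close> in another direction \<open>i\<close>, and let \<open>z\<close> be the fourth
  corner of the square. As \<open>M\<close> raises \<open>M x\<close> to \<open>x\<close>, it cannot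
  lower \<open>z\<close>; so it raises \<open>z\<close>, necessarily to \<open>y\<close>, although
  it also raises \<open>y\<close>.\<close>

lemma direction_down_up:
  assumes sp: "special_matching P R M" and xy: "covered_by P R x y"
    and dx: "covered_by P R (M x) x" and uy: "covered_by P R y (M y)"
    and neq: "x j \<noteq> y j"
  shows "M x j \<noteq> x j"
proof
  assume fixed: "M x j = x j"
  have m: "matching P R M"
    using sp by (simp add: special_matching_def)
  have P: "x \<in> P" "y \<in> P" "M x \<in> P"
    using xy dx by (auto simp: covered_by_def)
  obtain j' where "j' \<in> I" "covered_by (K j') (r j') (x j') (y j')" "y = x(j' := y j')"
    using xy by (rule covered_by_productE)
  moreover from this have "j' = j"
    using neq by (metis fun_upd_other)
  ultimately have j: "j \<in> I" "covered_by (K j) (r j) (x j) (y j)" "y = x(j := y j)"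
    by auto
  obtain i where i: "i \<in> I" "M x i \<noteq> x i" "M x = x(i := M x i)"
    "covered_by (K i) (r i) (M x i) (x i)"
    using matching_direction[OF m P(1)] dx by metis
  have ij: "i \<noteq> j"
    using i(2) fixed by auto
  have yi: "y i = x i"
    using j(3) ij by (metis fun_upd_other)
  \<comment> \<open>From \<open>M x\<close>, direction \<open>j\<close> leads to \<open>z\<close>,
    and direction \<open>i\<close> then leads to \<open>y\<close>.\<close>
  define z where "z = (M x)(j := y j)"
  have xz: "covered_by P R (M x) z"
    unfolding z_def using covered_by_updI[OF P(3) j(1)] j(2) fixed by simp
  have zP: "z \<in> P"
    using xz by (simp add: covered_by_def)
  have zy: "z(i := x i) = y"
  proof
    fix k show "(z(i := x i)) k = y k"
      using fun_cong[OF i(3), of k] fun_cong[OF j(3), of k] yi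
      by (cases "k = i"; cases "k = j") (simp_all add: z_def)
  qed
  have zi: "z i = M x i"
    using ij by (simp add: z_def)
  have MMx: "M (M x) = x"
    using matching_involution(2)[OF m P(1)] .
  have xnz: "M (M x) \<noteq> z"
    using MMx zi i(2) by metis
  have ux: "covered_by P R (M x) (M (M x))"
    using MMx dx by simp
  from m zP show False
  proof (cases rule: matching_cases)
    case down
    then show False
      using special_matching_up_down[OF partial_order_product sp xz ux] xnz by simp
  next
    case up
    with parallel_up_up[OF sp xz xnz ux] have "parallel M (M x) z" .
    then obtain i' where i': "M (M x) i' \<noteq> M x i'" "M z = z(i' := M z i')"
      "M x i' = z i' \<longrightarrow> M (M x) i' = M z i'"
      unfolding parallel_def by blast
    \<comment> \<open>Only coordinate \<open>i\<close> changes from \<open>M x\<close> to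
      \<open>x\<close>, and \<open>z\<close> agrees with \<open>M x\<close> there, so
      \<open>M z\<close> receives the value \<open>x i\<close>.\<close>
    have "i' = i"
      using i'(1) MMx i(3) by (metis fun_upd_other)
    then have "M z = y"
      using i'(2,3) zi zy MMx by simp
    then show False
      using up uy matching_involution(2)[OF m zP]
        covered_by_asym[OF partial_order_product] by metis
  qed
qed

text \<open>Reversal exchanges \<open>x\<close> with \<open>y\<close> and lowering with raising, so
  this configuration is its own dual.\<close>

lemma direction_down_up':
  assumes "special_matching P R M" "covered_by P R x y"
    and "covered_by P R (M x) x" "covered_by P R y (M y)" "x j \<noteq> y j"
  shows "M y j \<noteq> y j"
proof -
  interpret dual: poset_family I K "\<lambda>j. (r j)\<inverse>"
    by (rule poset_family_converse)
  show ?thesis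
    using assms
    by (intro dual.direction_down_up[of M y x])
      (simp_all add: dual_simps special_matching_converse)
qed

text \<open>If \<open>M x\<close> \<noteq> \<open>y\<close>, raising \<open>x\<close> while lowering
  \<open>y\<close> is excluded, and two moves of the same kind are settled above. In the remaining
  case, as for \<open>M x = y\<close>, both moves go in the direction \<open>j\<close> of the cover,
  where \<open>x j\<close> \<noteq> \<open>y j\<close> makes the condition on values
  vacuous.\<close>

lemma special_matching_parallel:
  assumes sp: "special_matching P R M" and xy: "covered_by P R x y"
  shows "parallel M x y"
proof -
  have m: "matching P R M"
    using sp by (simp add: special_matching_def)
  have P: "x \<in> P" "y \<in> P"
    using xy by (auto simp: covered_by_def)
  obtain j where j: "j \<in> I" "covered_by (K j) (r j) (x j) (y j)" "y = x(j := y j)"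
    using xy by (rule covered_by_productE)
  have neq: "x j \<noteq> y j"
    using j(2) by (simp add: covered_by_def)
  have only: "M w = w(j := M w j)" if "w \<in> P" "M w j \<noteq> w j" for w
    using matching_direction[OF m that(1)] that(2) by (metis fun_upd_other)
  have parallelI: "parallel M x y" if "M x j \<noteq> x j" "M y j \<noteq> y j"
    unfolding parallel_def using j(1) neq that only P by blast
  show ?thesis
  proof (cases "M x = y")
    case True
    then have "M y = x"
      using matching_involution(2)[OF m P(1)] by simp
    with True neq show ?thesis
      by (intro parallelI) auto
  next
    case False
    from m P(1) show ?thesis
    proof (cases rule: matching_cases)
      case xdown: down
      from m P(2) show ?thesis
      proof (cases rule: matching_cases)
        case down
        with xdown False show ?thesis
          by (intro parallel_down_down[OF sp xy])
      next
        case up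
        with xdown show ?thesis
          using direction_down_up[OF sp xy _ _ neq] direction_down_up'[OF sp xy _ _ neq]
          by (intro parallelI)
      qed
    next
      case xup: up
      from m P(2) show ?thesis
      proof (cases rule: matching_cases)
        case down
        with xup False show ?thesis
          using special_matching_up_down[OF partial_order_product sp xy] by blast
      next
        case up
        with xup False show ?thesis
          by (intro parallel_up_up[OF sp xy])
      qed
    qed
  qed
qed

section \<open>Special matchings of a product and of its factors\<close>

text \<open>Away from \<open>i\<close> the images inherit \<open>x\<close> \<le> \<open>y\<close>.
  At \<open>i\<close>, either the cover runs in direction \<open>i\<close> and specialness of
  \<open>N\<close> applies, or the two entries agree and have the same image.\<close>

lemma special_matching_product_map:
  assumes i: "i \<in> I" and N: "special_matching (K i) (r i) N"
  shows "special_matching P R (product_map I K (\<lambda>j. if j = i then N else id))"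
    (is "special_matching P R ?M")
proof -
  have mN: "matching (K i) (r i) N"
    using N by (simp add: special_matching_def)
  have M: "?M x = x(i := N (x i))" if "x \<in> P" for x
    using that i by (auto simp: product_map_def fun_eq_iff PiE_def extensional_def)
  have NK: "N (x i) \<in> K i" "N (N (x i)) = x i" if "x \<in> P" for x
    using matching_involution[OF mN, of "x i"] that i by auto
  have MP: "?M x \<in> P" if "x \<in> P" for x
    using M NK(1) upd_in_P i that by simp
  have invol: "?M (?M x) = x" if "x \<in> P" for x
    using M[OF MP[OF that]] M[OF that] NK(2)[OF that] by simp
  have cov: "covered_by P R (?M x) x \<or> covered_by P R x (?M x)" if x: "x \<in> P" for x
  proof -
    have "x i \<in> K i"
      using x i by auto
    with mN show ?thesis
    proof (cases rule: matching_cases)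
      case up
      then show ?thesis
        using covered_by_updI[OF x i] M[OF x] by simp
    next
      case down
      then show ?thesis
        \<comment> \<open>Putting \<open>x i\<close> back at coordinate \<open>i\<close> of
          \<open>?M x\<close> recovers \<open>x\<close>.\<close>
        using covered_by_updI[OF MP[OF x] i, of "x i"] M[OF x] by simp
    qed
  qed
  have "?M \<in> P \<rightarrow>\<^sub>E P"
    using MP by (auto simp: PiE_def Pi_def extensional_def product_map_def)
  then have "matching P R ?M"
    using invol cov by (simp add: matching_def)
  moreover have "(?M x, ?M y) \<in> R" if xy: "covered_by P R x y" and neq: "x \<noteq> ?M y" for x y
  proof -
    have P: "x \<in> P" "y \<in> P"
      using xy by (auto simp: covered_by_def)
    obtain j where j: "j \<in> I" "covered_by (K j) (r j) (x j) (y j)" "y = x(j := y j)"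
      using xy by (rule covered_by_productE)
    have off: "(x k, y k) \<in> r k" if "k \<in> I" for k
      using xy that by (auto simp: covered_by_def product_order_def)
    have "(N (x i), N (y i)) \<in> r i"
    proof (cases "j = i")
      case True
      have "N (x i) \<noteq> y i"
      proof
        assume "N (x i) = y i"
        then have "N (y i) = x i"
          using NK(2)[OF P(1)] by simp
        then have "?M y = x"
          using M[OF P(2)] j(3) True by (metis fun_upd_upd fun_upd_triv)
        with neq show False by simp
      qed
      then show ?thesis
        using special_matching_le[OF N] j(2) True by simp
    next
      case False
      then have "y i = x i"
        using j(3) by (metis fun_upd_other)
      then show ?thesis
        using refl[OF i NK(1)[OF P(1)]] by simp
    qed
    then show ?thesis
      using off MP[OF P(1)] MP[OF P(2)] M[OF P(1)] M[OF P(2)]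
      by (auto simp: product_order_def)
  qed
  ultimately show ?thesis
    by (simp add: special_matching_def)
qed

text \<open>Induction along covers from the minimum spreads first the direction \<open>i\<close> and
  then the dependence of \<open>M x i\<close> on \<open>x i\<close> alone. The properties of
  \<open>N\<close> are those of \<open>M\<close> on the copy of \<open>K i\<close> through the
  minimum.\<close>

lemma special_matching_product_decompose:
  assumes "finite I" "\<And>j. j \<in> I \<Longrightarrow> finite (K j)"
    and "\<And>j. j \<in> I \<Longrightarrow> \<exists>b. is_minimum (K j) (r j) b"
    and sp: "special_matching P R M"
  shows "\<exists>i\<in>I. \<exists>N. special_matching (K i) (r i) N \<and>
    M = product_map I K (\<lambda>j. if j = i then N else id)"
proof -
  have m: "matching P R M"
    using sp by (simp add: special_matching_def)
  obtain b where "\<And>j. j \<in> I \<Longrightarrow> is_minimum (K j) (r j) (b j)"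
    using assms(3) by metis
  then have min: "is_minimum P R (restrict b I)"
    by (rule is_minimum_product)
  define b0 where "b0 = restrict b I"
  have b0: "b0 \<in> P"
    using min by (simp add: b0_def is_minimum_def)
  have "finite P"
    using assms by (intro finite_PiE)
  note induct = covered_by_induct[OF this partial_order_product min[folded b0_def]]
  \<comment> \<open>The direction at the minimum. Its existence also rules out an empty index set,
    whose one-point product has no matching.\<close>
  obtain i where i: "i \<in> I" "M b0 i \<noteq> b0 i"
    using matching_direction[OF m b0] by metis
  have dir: "M x i \<noteq> x i" if "x \<in> P" for x
    using that
  proof (rule induct)
    show "M b0 i \<noteq> b0 i" by fact
    fix x y assume "covered_by P R x y" "M x i \<noteq> x i"
    then show "M y i \<noteq> y i"
      using special_matching_parallel[OF sp] unfolding parallel_def by (metis fun_upd_other)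
  qed
  have only: "M x = x(i := M x i)" if "x \<in> P" for x
    using matching_direction[OF m that] dir[OF that] by (metis fun_upd_other)
  \<comment> \<open>The restricted abstraction makes \<open>N\<close> extensional, as
    \<open>matching\<close> demands.\<close>
  define N where "N = (\<lambda>t\<in>K i. M (b0(i := t)) i)"
  \<comment> \<open>Quantifying over \<open>t\<close> frees the claim from \<open>x i\<close>, so
    covers in direction \<open>i\<close> preserve it trivially.\<close>
  have "\<forall>t\<in>K i. M (x(i := t)) i = N t" if "x \<in> P" for x
    using that
  proof (rule induct)
    show "\<forall>t\<in>K i. M (b0(i := t)) i = N t"
      by (simp add: N_def)
    fix x y assume xy: "covered_by P R x y" and IH: "\<forall>t\<in>K i. M (x(i := t)) i = N t"
    have "x \<in> P"
      using xy by (simp add: covered_by_def)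
    obtain j where j: "j \<in> I" "covered_by (K j) (r j) (x j) (y j)" "y = x(j := y j)"
      using xy by (rule covered_by_productE)
    show "\<forall>t\<in>K i. M (y(i := t)) i = N t"
    proof
      fix t assume t: "t \<in> K i"
      show "M (y(i := t)) i = N t"
      proof (cases "j = i")
        case True
        then have "y(i := t) = x(i := t)"
          using j(3) by (metis fun_upd_upd)
        with IH t show ?thesis by simp
      next
        case False
        \<comment> \<open>A cover in direction \<open>j\<close> \<noteq> \<open>i\<close> persists
          when entry \<open>i\<close> is set to \<open>t\<close> on both sides. These entries then
          agree, so \<open>parallel\<close> equates the new values at \<open>i\<close>.\<close>
        have xt: "x(i := t) \<in> P"
          using upd_in_P \<open>x \<in> P\<close> i t by blast
        moreover have "y(i := t) = (x(i := t))(j := y j)"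
          using False j(3) by (metis fun_upd_twist)
        ultimately have "covered_by P R (x(i := t)) (y(i := t))"
          using covered_by_updI[OF xt j(1)] j(2) False by simp
        then have "parallel M (x(i := t)) (y(i := t))"
          by (rule special_matching_parallel[OF sp])
        then obtain i' where i': "M (x(i := t)) = (x(i := t))(i' := M (x(i := t)) i')"
          "(x(i := t)) i' = (y(i := t)) i' \<longrightarrow> M (x(i := t)) i' = M (y(i := t)) i'"
          unfolding parallel_def by blast
        have "i' = i"
          using i'(1) dir[OF xt] by (metis fun_upd_other)
        with i'(2) have "M (y(i := t)) i = M (x(i := t)) i"
          by simp
        with IH t show ?thesis by simp
      qed
    qed
  qed
  then have Mi: "M x i = N (x i)" if "x \<in> P" for x
    using that i(1) by (metis PiE_mem fun_upd_triv)
  with only have M: "M x = x(i := N (x i))" if "x \<in> P" for x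
    using that by metis
  have bP: "b0(i := t) \<in> P" if "t \<in> K i" for t
    using upd_in_P b0 i(1) that by blast
  have Mb: "M (b0(i := t)) = b0(i := N t)" if "t \<in> K i" for t
    using M[OF bP[OF that]] by simp
  have NK: "N t \<in> K i" if "t \<in> K i" for t
    using matching_involution(1)[OF m bP[OF that]] Mb[OF that] i(1) by (metis PiE_mem fun_upd_same)
  have NN: "N (N t) = t" if "t \<in> K i" for t
    using matching_involution(2)[OF m bP[OF that]] Mb[OF that] Mb[OF NK[OF that]]
    by (metis fun_upd_same)
  \<comment> \<open>The two elements can differ only at \<open>i\<close>, and covers are strict, so
    the cover must run in direction \<open>i\<close>.\<close>
  have cov: "covered_by (K i) (r i) s t" if st: "covered_by P R (b0(i := s)) (b0(i := t))" for s t
    using st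
  proof (rule covered_by_productE)
    fix j assume "covered_by (K j) (r j) ((b0(i := s)) j) ((b0(i := t)) j)"
    then show ?thesis
      by (cases "j = i") (auto simp: covered_by_def)
  qed
  have "N \<in> K i \<rightarrow>\<^sub>E K i"
    using NK unfolding N_def by (intro PiE_I) (auto simp: extensional_def)
  moreover have "covered_by (K i) (r i) (N t) t \<or> covered_by (K i) (r i) t (N t)" if "t \<in> K i" for t
    using m bP[OF that]
  proof (cases rule: matching_cases)
    case down
    then show ?thesis using Mb[OF that] cov by simp
  next
    case up
    then show ?thesis using Mb[OF that] cov by simp
  qed
  ultimately have mN: "matching (K i) (r i) N"
    using NN by (simp add: matching_def)
  have "(N s, N t) \<in> r i" if "s \<in> K i" "t \<in> K i" "covered_by (K i) (r i) s t" "s \<noteq> N t" for s t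
  proof -
    have "covered_by P R (b0(i := s)) (b0(i := t))"
      using covered_by_updI[OF bP[OF that(1)] i(1), of t] that(3) by simp
    moreover have "M (b0(i := s)) \<noteq> b0(i := t)"
      using Mb[OF that(1)] NN[OF that(1)] that(4) by (metis fun_upd_same)
    ultimately have "(b0(i := N s), b0(i := N t)) \<in> R"
      using special_matching_le[OF sp] Mb that(1,2) by metis
    then show ?thesis
      using i(1) by (auto simp: product_order_def)
  qed
  with mN have "special_matching (K i) (r i) N"
    by (simp add: special_matching_def)
  moreover have "M = product_map I K (\<lambda>j. if j = i then N else id)"
  proof
    fix x show "M x = product_map I K (\<lambda>j. if j = i then N else id) x"
    proof (cases "x \<in> P")
      case True
      then show ?thesis
        using M[OF True] i(1) by (auto simp: product_map_def fun_eq_iff PiE_def extensional_def)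
    next
      case False
      \<comment> \<open>Outside \<open>P\<close> both maps take the default value
        \<open>undefined\<close>.\<close>
      have "M \<in> P \<rightarrow>\<^sub>E P"
        using m by (simp add: matching_def)
      then have "M x = undefined"
        using False by (rule PiE_arb)
      with False show ?thesis
        by (simp add: product_map_def)
    qed
  qed
  ultimately show ?thesis
    using i(1) by blast
qed

end

theorem theorem4p5:
  fixes n :: nat
    and K :: "nat \<Rightarrow> 'a set"
    and r :: "nat \<Rightarrow> 'a rel"
    and M :: "(nat \<Rightarrow> 'a) \<Rightarrow> (nat \<Rightarrow> 'a)"
  assumes "\<And>j. j \<in> {1..n} \<Longrightarrow> finite_graded_poset (K j) (r j)"
    and "M \<in> Pi\<^sub>E {1..n} K \<rightarrow>\<^sub>E Pi\<^sub>E {1..n} K"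
  shows "special_matching (Pi\<^sub>E {1..n} K) (product_order {1..n} K r) M \<longleftrightarrow>
    (\<exists>i\<in>{1..n}. \<exists>N. special_matching (K i) (r i) N \<and>
       M = product_map {1..n} K (\<lambda>j. if j = i then N else id))"
proof -
  interpret poset_family "{1..n}" K r
    using assms(1) by unfold_locales (simp add: finite_graded_poset_def)
  show ?thesis
  proof
    assume "special_matching (Pi\<^sub>E {1..n} K) (product_order {1..n} K r) M"
    then show "\<exists>i\<in>{1..n}. \<exists>N. special_matching (K i) (r i) N \<and>
        M = product_map {1..n} K (\<lambda>j. if j = i then N else id)"
      using assms(1)
      by (intro special_matching_product_decompose) (auto simp: finite_graded_poset_def)
  qed (use special_matching_product_map in blast)
qed

end
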